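(* Let $\Sigma$ be a $k$-dimensional isotropic submanifold of $\mathbb{C}^n$ that is an initial data with respect to $(B,b)$, where $B\in GL(n,\mathbb{C})$ and $b\in\mathbb{C}^n$. Let $I\subset\mathbb{R}$ be an interval containing $0$ and let $\alpha: I\to\mathbb{C}$ be any smooth curve. Suppose $(A(s),a(s))$, with $A(s)\in GL(n,\mathbb{C})$ and $a(s)\in\mathbb{C}^n$ for $s\in I$, is a smooth curve satisfying $$A^*(s)\dot A(s)=\alpha(s)B,\qquad A^*(s)\dot a(s)=\alpha(s)b,\qquad A(0)=\mathrm{Id},\qquad a(0)=0,$$ where $A^*$ is the conjugate transpose of $A$ and the dot denotes $d/ds$. Then $A(s)\Sigma+a(s)$, that is, the submanifold of $\mathbb{C}^n$ parametrized by $$F: I\times\Sigma\to\mathbb{C}^n,\qquad F(s,p)=A(s)X_p+a(s),$$ is isotropic.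
   Context: $\mathbb{C}^n$ carries its standard Hermitian product $\langle\cdot,\cdot\rangle$ and standard Kähler form $\omega$ (up to sign, $\omega$ is the imaginary part of $\langle\cdot,\cdot\rangle$). For a submanifold $\Sigma$ and $p\in\Sigma$, $X_p\in\mathbb{C}^n$ denotes the position vector of $p$. A submanifold is isotropic if $\omega$ restricts to zero on it; a submanifold parametrized by a map $F$ (not necessarily embedded) is isotropic if $F^*\omega=0$. A $k$-dimensional isotropic submanifold $\Sigma$ of $\mathbb{C}^n$ is called an initial data with respect to $(B,b)$, with $B\in GL(n,\mathbb{C})$ and $b\in\mathbb{C}^n$, if at every point $p\in\Sigma$ one has $\langle V, BX_p+b\rangle=0$ for all $V\in T_p\Sigma$ (vanishing of the full complex-valued Hermitian product). *)

theory Defs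
  imports "HOL-Analysis.Analysis"
begin

definition hermitian :: "complex^'n \<Rightarrow> complex^'n \<Rightarrow> complex" where
  "hermitian x y = (\<Sum>i\<in>UNIV. x $ i * cnj (y $ i))"

text \<open>In coordinates \<open>z\<^sub>j = x\<^sub>j + i y\<^sub>j\<close> this is \<open>\<Sum>\<^sub>j dx\<^sub>j \<and> dy\<^sub>j\<close>.\<close>

definition kaehler_form :: "complex^'n \<Rightarrow> complex^'n \<Rightarrow> real" where
  "kaehler_form x y = - Im (hermitian x y)"

definition conj_transpose :: "complex^'n^'m \<Rightarrow> complex^'m^'n" where
  "conj_transpose A = (\<chi> i j. cnj (A $ j $ i))"

text \<open>The definition is used for open subsets of linear subspaces and for
  intervals of reals (one-sided derivatives at end points).\<close>

primrec Ck_on :: "nat \<Rightarrow> 'a::real_normed_vector set \<Rightarrow> ('a \<Rightarrow> 'b::real_normed_vector) \<Rightarrow> bool" where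
  "Ck_on 0 S f \<longleftrightarrow> continuous_on S f"
| "Ck_on (Suc k) S f \<longleftrightarrow>
     (\<exists>f'. (\<forall>x\<in>S. (f has_derivative f' x) (at x within S)) \<and> (\<forall>v. Ck_on k S (\<lambda>x. f' x v)))"

definition smooth_on :: "'a::real_normed_vector set \<Rightarrow> ('a \<Rightarrow> 'b::real_normed_vector) \<Rightarrow> bool" where
  "smooth_on S f \<longleftrightarrow> (\<forall>k. Ck_on k S f)"

text \<open>A submanifold \<open>\<Sigma>\<close> of a Euclidean space is given by a topological space \<open>M\<close> together with
  its position map \<open>X\<close>, which is an immersion; the embedded submanifold with underlying set \<open>S\<close>
  is the case \<open>M = top_of_set S\<close>, \<open>X = id\<close>. The smooth structure is
  encoded through local parametrizations \<open>\<phi>\<close> defined on open subsets \<open>D\<close> of a \<open>k\<close>-dimensional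
  linear subspace \<open>L\<close> of the ambient space, which plays the role of \<open>\<real>\<^sup>k\<close> (so that \<open>k\<close> is a natural
  number, \<open>k = 0\<close> included). No compatibility condition is needed: as \<open>X \<circ> \<phi>\<close> is an immersion
  for every \<open>\<phi>\<close>, the transition homeomorphisms are automatically smooth.\<close>

definition local_param ::
    "'a topology \<Rightarrow> ('a \<Rightarrow> 'b::euclidean_space) \<Rightarrow> 'b set \<Rightarrow> 'b set \<Rightarrow> ('b \<Rightarrow> 'a) \<Rightarrow> bool" where
  "local_param M X L D \<phi> \<longleftrightarrow>
     subspace L \<and> openin (top_of_set L) D \<and> openin M (\<phi> ` D) \<and>
     homeomorphic_map (top_of_set D) (subtopology M (\<phi> ` D)) \<phi> \<and>
     smooth_on D (X \<circ> \<phi>) \<and>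
     (\<forall>u\<in>D. \<exists>G. ((X \<circ> \<phi>) has_derivative G) (at u within D) \<and> inj_on G L)"

definition submanifold :: "nat \<Rightarrow> 'a topology \<Rightarrow> ('a \<Rightarrow> 'b::euclidean_space) \<Rightarrow> bool" where
  "submanifold k M X \<longleftrightarrow>
     Hausdorff_space M \<and> second_countable M \<and>
     (\<forall>p\<in>topspace M. \<exists>L D \<phi>. dim L = k \<and> local_param M X L D \<phi> \<and> p \<in> \<phi> ` D)"

definition tangent_space :: "'a topology \<Rightarrow> ('a \<Rightarrow> 'b::euclidean_space) \<Rightarrow> 'a \<Rightarrow> 'b set" where
  "tangent_space M X p =
     {G v | L D \<phi> u G v. local_param M X L D \<phi> \<and> u \<in> D \<and> \<phi> u = p \<and>
        ((X \<circ> \<phi>) has_derivative G) (at u within D) \<and> v \<in> L}"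

definition isotropic_submanifold :: "nat \<Rightarrow> 'a topology \<Rightarrow> ('a \<Rightarrow> complex^'n) \<Rightarrow> bool" where
  "isotropic_submanifold k M X \<longleftrightarrow>
     submanifold k M X \<and>
     (\<forall>p\<in>topspace M. \<forall>V\<in>tangent_space M X p. \<forall>W\<in>tangent_space M X p. kaehler_form V W = 0)"

definition initial_data ::
    "nat \<Rightarrow> 'a topology \<Rightarrow> ('a \<Rightarrow> complex^'n) \<Rightarrow> complex^'n^'n \<Rightarrow> complex^'n \<Rightarrow> bool" where
  "initial_data k M X B b \<longleftrightarrow>
     isotropic_submanifold k M X \<and>
     (\<forall>p\<in>topspace M. \<forall>V\<in>tangent_space M X p. hermitian V (B *v X p + b) = 0)"

text \<open>\<open>F\<^sup>*\<omega> = 0\<close> for a map \<open>F\<close> on the product \<open>I \<times> \<Sigma>\<close>, where \<open>\<Sigma>\<close> is the submanifold \<open>(M, X)\<close>, expressed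
  in the local parametrizations \<open>(s, u) \<mapsto> (s, \<phi> u)\<close> of \<open>I \<times> \<Sigma>\<close>, whose tangent directions are the
  elements of \<open>\<real> \<times> L\<close>.\<close>

definition isotropic_map ::
    "real set \<Rightarrow> 'a topology \<Rightarrow> ('a \<Rightarrow> complex^'n) \<Rightarrow> (real \<times> 'a \<Rightarrow> complex^'n) \<Rightarrow> bool" where
  "isotropic_map I M X F \<longleftrightarrow>
     (\<forall>L D \<phi>. local_param M X L D \<phi> \<longrightarrow>
        (\<forall>s\<in>I. \<forall>u\<in>D. \<exists>G.
           ((\<lambda>(t, w). F (t, \<phi> w)) has_derivative G) (at (s, u) within I \<times> D) \<and>
           (\<forall>\<xi>\<in>UNIV \<times> L. \<forall>\<eta>\<in>UNIV \<times> L. kaehler_form (G \<xi>) (G \<eta>) = 0)))"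

end

theory Submission
  imports Defs
begin

text \<open>The tangent vectors of \<open>F\<close> are spanned by \<open>A V\<close>, with \<open>V\<close> tangent to \<open>\<Sigma>\<close>, and \<open>A' X + a'\<close>. As
  \<open>A\<^sup>*(A' X + a') = \<alpha>(B X + b)\<close>, the mixed products \<open>\<langle>A V, A' X + a'\<rangle>\<close> vanish by the initial data
  condition. Differentiating that condition along \<open>\<Sigma>\<close> and using the symmetry of second derivatives
  shows that \<open>\<langle>V, B W\<rangle>\<close> is symmetric in the tangent vectors \<open>V\<close>, \<open>W\<close>. Hence
  \<open>d/ds \<langle>A V, A W\<rangle> = cnj \<langle>A W, A' V\<rangle> + \<langle>A V, A' W\<rangle> = cnj (cnj \<alpha> \<langle>W, B V\<rangle>) + cnj \<alpha> \<langle>V, B W\<rangle>\<close> is real, so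
  \<open>\<omega>(A V, A W)\<close> keeps its value \<open>\<omega>(V, W) = 0\<close> at \<open>s = 0\<close>.\<close>

section \<open>Derivatives on relatively open subsets of a subspace\<close>

lemma eventually_nhds_parallelogram:
  fixes u v w :: "'a::real_normed_vector"
  assumes "eventually P (nhds u)"
  shows "\<forall>\<^sub>F h in at_right 0. \<forall>s\<in>{0..h}. \<forall>t\<in>{0..h}. P (u + s *\<^sub>R v + t *\<^sub>R w)"
proof -
  obtain e where "e > 0" and P: "\<And>x. dist x u < e \<Longrightarrow> P x"
    using assms by (auto simp: eventually_nhds_metric)
  have "((\<lambda>h. h * (norm v + norm w)) \<longlongrightarrow> 0) (at_right 0)"
    by (auto intro!: tendsto_eq_intros)
  then have "\<forall>\<^sub>F h in at_right 0. h * (norm v + norm w) < e"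
    using \<open>e > 0\<close> by (rule order_tendstoD)
  then show ?thesis
  proof eventually_elim
    case (elim h)
    have "dist (u + s *\<^sub>R v + t *\<^sub>R w) u < e" if "s \<in> {0..h}" "t \<in> {0..h}" for s t
    proof -
      have "dist (u + s *\<^sub>R v + t *\<^sub>R w) u = norm (s *\<^sub>R v + t *\<^sub>R w)"
        by (simp add: dist_norm add.assoc)
      also have "\<dots> \<le> s * norm v + t * norm w"
        using norm_triangle_ineq[of "s *\<^sub>R v" "t *\<^sub>R w"] that by simp
      also have "\<dots> \<le> h * norm v + h * norm w"
        using that by (intro add_mono mult_right_mono) auto
      finally show ?thesis
        using elim by (simp add: distrib_left)
    qed
    with P show ?case by blast
  qed
qed

lemma openin_subspace_eventually_parallelogram:
  fixes u v w :: "'a::real_normed_vector"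
  assumes "subspace L" and "openin (top_of_set L) D" and "u \<in> D" and "v \<in> L" and "w \<in> L"
  shows "\<forall>\<^sub>F h in at_right 0. \<forall>s\<in>{0..h}. \<forall>t\<in>{0..h}. u + s *\<^sub>R v + t *\<^sub>R w \<in> D"
proof -
  obtain U where "open U" and D: "D = L \<inter> U"
    using assms(2) by (auto simp: openin_open)
  then have "eventually (\<lambda>x. x \<in> U) (nhds u)"
    using \<open>u \<in> D\<close> by (intro eventually_nhds_in_open) auto
  then have "\<forall>\<^sub>F h in at_right 0. \<forall>s\<in>{0..h}. \<forall>t\<in>{0..h}. u + s *\<^sub>R v + t *\<^sub>R w \<in> U"
    by (rule eventually_nhds_parallelogram)
  moreover have "u + s *\<^sub>R v + t *\<^sub>R w \<in> L" for s t
    using assms D by (simp add: subspace_add subspace_scale)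
  ultimately show ?thesis
    by (auto simp: D elim: eventually_mono)
qed

lemma has_vector_derivative_along_line:
  assumes "(f has_derivative f') (at (u + s *\<^sub>R v) within D)"
    and "\<And>r. r \<in> S \<Longrightarrow> u + r *\<^sub>R v \<in> D"
  shows "((\<lambda>r. f (u + r *\<^sub>R v)) has_vector_derivative f' v) (at s within S)"
proof -
  have "((\<lambda>r. u + r *\<^sub>R v) has_vector_derivative v) (at s within S)"
    by (auto simp: has_vector_derivative_def intro!: derivative_eq_intros)
  moreover have "(f has_derivative f') (at (u + s *\<^sub>R v) within (\<lambda>r. u + r *\<^sub>R v) ` S)"
    using assms by (auto intro: has_derivative_subset)
  ultimately show ?thesis
    using vector_derivative_diff_chain_within by (fastforce simp: o_def)
qed

lemma has_derivative_unique_on_subspace: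
  assumes "subspace L" and "openin (top_of_set L) D" and "u \<in> D" and "v \<in> L"
    and f': "(f has_derivative f') (at u within D)"
    and f'': "(f has_derivative f'') (at u within D)"
  shows "f' v = f'' v"
proof -
  have "\<forall>\<^sub>F h in at_right 0. \<forall>s\<in>{0..h}. \<forall>t\<in>{0..h}. u + s *\<^sub>R v + t *\<^sub>R v \<in> D"
    using assms(1-4) assms(4) by (rule openin_subspace_eventually_parallelogram)
  moreover have "\<forall>\<^sub>F h in at_right (0::real). h > 0"
    by (rule eventually_at_right_less)
  ultimately have "\<forall>\<^sub>F h in at_right 0. h > 0 \<and> (\<forall>s\<in>{0..h}. u + s *\<^sub>R v \<in> D)"
    by eventually_elim force
  then obtain h where "h > 0" and D: "\<And>s. s \<in> {0..h} \<Longrightarrow> u + s *\<^sub>R v \<in> D"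
    using eventually_happens'[OF trivial_limit_at_right_real] by blast
  have "at 0 within {0..h} \<noteq> bot"
    using \<open>h > 0\<close> by (simp add: at_within_Icc_at_right)
  moreover have "((\<lambda>r. f (u + r *\<^sub>R v)) has_vector_derivative f' v) (at 0 within {0..h})"
    "((\<lambda>r. f (u + r *\<^sub>R v)) has_vector_derivative f'' v) (at 0 within {0..h})"
    using f' f'' D by (auto intro: has_vector_derivative_along_line[where D = D])
  ultimately show ?thesis
    by (rule vector_derivative_unique_within)
qed

lemma Ck_on_cong:
  assumes "\<And>x. x \<in> S \<Longrightarrow> f x = g x" and "Ck_on k S g"
  shows "Ck_on k S f"
proof (cases k)
  case 0
  with assms show ?thesis
    by (simp cong: continuous_on_cong)
next
  case (Suc k)
  with assms show ?thesis
    by (auto intro!: has_derivative_transform[OF _ assms(1)])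
qed

lemma Ck_on_Suc_derivative:
  assumes "Ck_on (Suc k) D f" and "subspace L" and "openin (top_of_set L) D" and "v \<in> L"
    and "\<And>x. x \<in> D \<Longrightarrow> (f has_derivative f' x) (at x within D)"
  shows "Ck_on k D (\<lambda>x. f' x v)"
proof -
  obtain F where F: "\<And>x. x \<in> D \<Longrightarrow> (f has_derivative F x) (at x within D)"
    and "Ck_on k D (\<lambda>x. F x v)"
    using assms(1) by auto
  moreover have "f' x v = F x v" if "x \<in> D" for x
    using assms(2,3) that assms(4) assms(5)[OF that] F[OF that]
    by (rule has_derivative_unique_on_subspace)
  ultimately show ?thesis
    using Ck_on_cong[of D "\<lambda>x. f' x v" "\<lambda>x. F x v"] by blast
qed

lemma smooth_on_has_vector_derivative:
  assumes "smooth_on S f" and "s \<in> S"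
  shows "(f has_vector_derivative vector_derivative f (at s within S)) (at s within S)"
proof -
  have "Ck_on (Suc 0) S f"
    using assms(1) by (simp only: smooth_on_def)
  with \<open>s \<in> S\<close> show ?thesis
    by (auto simp: vector_derivative_works[symmetric] differentiable_def)
qed

section \<open>Symmetry of second derivatives\<close>

lemma norm_increment_minus_linear_le:
  fixes f :: "real \<Rightarrow> 'a::real_normed_vector"
  assumes "a \<le> b"
    and f': "\<And>x. x \<in> {a..b} \<Longrightarrow> (f has_vector_derivative f' x) (at x within {a..b})"
    and bound: "\<And>x. x \<in> {a..b} \<Longrightarrow> norm (f' x - c) \<le> e"
  shows "norm (f b - f a - (b - a) *\<^sub>R c) \<le> e * (b - a)"
proof -
  have "norm ((f b - b *\<^sub>R c) - (f a - a *\<^sub>R c)) \<le> e * norm (b - a)"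
  proof (rule differentiable_bound)
    show "((\<lambda>x. f x - x *\<^sub>R c) has_derivative (\<lambda>r. r *\<^sub>R (f' x - c))) (at x within {a..b})"
      if "x \<in> {a..b}" for x
      using f'[OF that]
      by (auto simp: has_vector_derivative_def algebra_simps intro!: derivative_eq_intros)
    show "onorm (\<lambda>r. r *\<^sub>R (f' x - c)) \<le> e" if "x \<in> {a..b}" for x
      using mult_right_mono[OF bound[OF that] abs_ge_zero] by (intro onorm_le) (simp add: mult.commute)
  qed (use \<open>a \<le> b\<close> in auto)
  then show ?thesis
    using \<open>a \<le> b\<close> by (simp add: algebra_simps)
qed

lemma norm_second_difference_minus_le:
  fixes f :: "'a::real_normed_vector \<Rightarrow> 'b::real_normed_vector"
  assumes "0 \<le> h"
    and D: "\<And>s t. s \<in> {0..h} \<Longrightarrow> t \<in> {0..h} \<Longrightarrow> u + s *\<^sub>R v + t *\<^sub>R w \<in> D"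
    and f: "\<And>x. x \<in> D \<Longrightarrow> (f has_derivative f' x) (at x within D)"
    and fv: "\<And>x. x \<in> D \<Longrightarrow> ((\<lambda>x. f' x v) has_derivative fv x) (at x within D)"
    and bound: "\<And>s t. s \<in> {0..h} \<Longrightarrow> t \<in> {0..h} \<Longrightarrow>
      norm (fv (u + s *\<^sub>R v + t *\<^sub>R w) w - c) \<le> e"
  shows "norm (f (u + h *\<^sub>R v + h *\<^sub>R w) - f (u + h *\<^sub>R v) - f (u + h *\<^sub>R w) + f u - h\<^sup>2 *\<^sub>R c)
    \<le> e * h\<^sup>2"
proof -
  have D': "(u + t *\<^sub>R w) + s *\<^sub>R v \<in> D" if "s \<in> {0..h}" "t \<in> {0..h}" for s t
    using D[OF that] by (simp add: algebra_simps)
  have f_line: "((\<lambda>s. f ((u + t *\<^sub>R w) + s *\<^sub>R v)) has_vector_derivative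
      f' ((u + t *\<^sub>R w) + s *\<^sub>R v) v) (at s within {0..h})"
    if "s \<in> {0..h}" "t \<in> {0..h}" for s t
    using that by (intro has_vector_derivative_along_line[where f = f and D = D] f D')
  have f'_increment: "norm (f' ((u + s *\<^sub>R v) + h *\<^sub>R w) v - f' ((u + s *\<^sub>R v) + 0 *\<^sub>R w) v
      - (h - 0) *\<^sub>R c) \<le> e * (h - 0)" if s: "s \<in> {0..h}" for s
  proof (rule norm_increment_minus_linear_le[OF \<open>0 \<le> h\<close>])
    show "((\<lambda>t. f' ((u + s *\<^sub>R v) + t *\<^sub>R w) v) has_vector_derivative
        fv ((u + s *\<^sub>R v) + t *\<^sub>R w) w) (at t within {0..h})" if "t \<in> {0..h}" for t
      using s that by (intro has_vector_derivative_along_line[where f = "\<lambda>x. f' x v" and D = D] fv D)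
  qed (use bound s in auto)
  let ?g = "\<lambda>s. f ((u + h *\<^sub>R w) + s *\<^sub>R v) - f ((u + 0 *\<^sub>R w) + s *\<^sub>R v)"
  let ?g' = "\<lambda>s. f' ((u + h *\<^sub>R w) + s *\<^sub>R v) v - f' ((u + 0 *\<^sub>R w) + s *\<^sub>R v) v"
  have "norm (?g h - ?g 0 - (h - 0) *\<^sub>R (h *\<^sub>R c)) \<le> (e * h) * (h - 0)"
  proof (rule norm_increment_minus_linear_le[OF \<open>0 \<le> h\<close>])
    show "(?g has_vector_derivative ?g' s) (at s within {0..h})" if "s \<in> {0..h}" for s
      using that \<open>0 \<le> h\<close> by (intro has_vector_derivative_diff f_line) auto
    show "norm (?g' s - h *\<^sub>R c) \<le> e * h" if "s \<in> {0..h}" for s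
      using f'_increment[OF that] by (simp add: add_ac)
  qed
  then show ?thesis
    by (simp add: power2_eq_square algebra_simps)
qed

lemma second_difference_quotient_tendsto:
  fixes f :: "'a::real_normed_vector \<Rightarrow> 'b::real_normed_vector"
  assumes "subspace L" and "openin (top_of_set L) D" and "u \<in> D" and "v \<in> L" and "w \<in> L"
    and f: "\<And>x. x \<in> D \<Longrightarrow> (f has_derivative f' x) (at x within D)"
    and fv: "\<And>x. x \<in> D \<Longrightarrow> ((\<lambda>x. f' x v) has_derivative fv x) (at x within D)"
    and cont: "continuous (at u within D) (\<lambda>x. fv x w)"
  shows "((\<lambda>h. (f (u + h *\<^sub>R v + h *\<^sub>R w) - f (u + h *\<^sub>R v) - f (u + h *\<^sub>R w) + f u) /\<^sub>R h\<^sup>2)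
    \<longlongrightarrow> fv u w) (at_right 0)" (is "(?q \<longlongrightarrow> _) _")
proof (rule tendstoI)
  fix e :: real
  assume "e > 0"
  then have "e / 2 > 0" by simp
  with cont have "\<forall>\<^sub>F x in nhds u. x \<in> D \<longrightarrow> norm (fv x w - fv u w) < e / 2"
    unfolding continuous_within_eps_delta eventually_nhds_metric dist_norm by blast
  then have "\<forall>\<^sub>F h in at_right 0. \<forall>s\<in>{0..h}. \<forall>t\<in>{0..h}. u + s *\<^sub>R v + t *\<^sub>R w \<in> D \<longrightarrow>
      norm (fv (u + s *\<^sub>R v + t *\<^sub>R w) w - fv u w) < e / 2"
    by (rule eventually_nhds_parallelogram)
  moreover have "\<forall>\<^sub>F h in at_right 0. \<forall>s\<in>{0..h}. \<forall>t\<in>{0..h}. u + s *\<^sub>R v + t *\<^sub>R w \<in> D"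
    using assms(1-5) by (rule openin_subspace_eventually_parallelogram)
  moreover have "\<forall>\<^sub>F h in at_right (0::real). h > 0"
    by (rule eventually_at_right_less)
  ultimately show "\<forall>\<^sub>F h in at_right 0. dist (?q h) (fv u w) < e"
  proof eventually_elim
    case (elim h)
    let ?d = "f (u + h *\<^sub>R v + h *\<^sub>R w) - f (u + h *\<^sub>R v) - f (u + h *\<^sub>R w) + f u"
    have "norm (?d - h\<^sup>2 *\<^sub>R fv u w) \<le> e / 2 * h\<^sup>2"
      using elim by (intro norm_second_difference_minus_le[where D = D and f' = f' and fv = fv] f fv)
        (auto intro: less_imp_le)
    moreover have "?d /\<^sub>R h\<^sup>2 - fv u w = (?d - h\<^sup>2 *\<^sub>R fv u w) /\<^sub>R h\<^sup>2"
      using elim by (simp add: scaleR_diff_right)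
    ultimately have "dist (?q h) (fv u w) \<le> e / 2"
      using elim by (simp only: dist_norm norm_scaleR) (simp add: divide_simps)
    with \<open>e > 0\<close> show ?case by simp
  qed
qed

lemma second_derivative_symmetric:
  fixes f :: "'a::real_normed_vector \<Rightarrow> 'b::real_normed_vector"
  assumes "subspace L" and "openin (top_of_set L) D" and "u \<in> D" and "v \<in> L" and "w \<in> L"
    and "\<And>x. x \<in> D \<Longrightarrow> (f has_derivative f' x) (at x within D)"
    and "\<And>x. x \<in> D \<Longrightarrow> ((\<lambda>x. f' x v) has_derivative fv x) (at x within D)"
    and "\<And>x. x \<in> D \<Longrightarrow> ((\<lambda>x. f' x w) has_derivative fw x) (at x within D)"
    and "continuous (at u within D) (\<lambda>x. fv x w)" and "continuous (at u within D) (\<lambda>x. fw x v)"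
  shows "fv u w = fw u v"
proof (rule tendsto_unique)
  show "((\<lambda>h. (f (u + h *\<^sub>R v + h *\<^sub>R w) - f (u + h *\<^sub>R v) - f (u + h *\<^sub>R w) + f u) /\<^sub>R h\<^sup>2)
      \<longlongrightarrow> fv u w) (at_right 0)"
    using assms(1-7,9) by (rule second_difference_quotient_tendsto)
  have "((\<lambda>h. (f (u + h *\<^sub>R w + h *\<^sub>R v) - f (u + h *\<^sub>R w) - f (u + h *\<^sub>R v) + f u) /\<^sub>R h\<^sup>2)
      \<longlongrightarrow> fw u v) (at_right 0)"
    using assms(1-3,5,4,6,8,10) by (rule second_difference_quotient_tendsto)
  then show "((\<lambda>h. (f (u + h *\<^sub>R v + h *\<^sub>R w) - f (u + h *\<^sub>R v) - f (u + h *\<^sub>R w) + f u) /\<^sub>R h\<^sup>2)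
      \<longlongrightarrow> fw u v) (at_right 0)"
    by (simp add: algebra_simps)
qed simp

lemma (in bounded_bilinear) derivative_of_vanishing_pairing_symmetric:
  fixes f :: "'d::real_normed_vector \<Rightarrow> 'a"
  assumes L: "subspace L" "openin (top_of_set L) D" and u: "u \<in> D" and vw: "v \<in> L" "w \<in> L"
    and f: "Ck_on 2 D f" "\<And>x. x \<in> D \<Longrightarrow> (f has_derivative f' x) (at x within D)"
    and g: "(g has_derivative g') (at u within D)"
    and vanish: "\<And>x v. x \<in> D \<Longrightarrow> v \<in> L \<Longrightarrow> prod (f' x v) (g x) = 0"
  shows "prod (f' u v) (g' w) = prod (f' u w) (g' v)"
proof -
  have "Ck_on (Suc 0) D (\<lambda>x. f' x v)" if "v \<in> L" for v
    using f(1)[unfolded numeral_2_eq_2] L that f(2) by (rule Ck_on_Suc_derivative)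
  then have "\<exists>F. (\<forall>x\<in>D. ((\<lambda>x. f' x v) has_derivative F x) (at x within D)) \<and>
      (\<forall>w. continuous_on D (\<lambda>x. F x w))" if "v \<in> L" for v
    using that by simp
  then obtain f''
    where f'': "\<And>x v. x \<in> D \<Longrightarrow> v \<in> L \<Longrightarrow> ((\<lambda>x. f' x v) has_derivative f'' v x) (at x within D)"
      and f''_cont: "\<And>v w. v \<in> L \<Longrightarrow> continuous_on D (\<lambda>x. f'' v x w)"
    by metis
  have product_rule: "prod (f' u v) (g' w) + prod (f'' v u w) (g u) = 0"
    if "v \<in> L" "w \<in> L" for v w
  proof (rule has_derivative_unique_on_subspace[OF L u \<open>w \<in> L\<close>])
    show "((\<lambda>x. prod (f' x v) (g x)) has_derivative
        (\<lambda>w. prod (f' u v) (g' w) + prod (f'' v u w) (g u))) (at u within D)"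
      using FDERIV[OF f''[OF u \<open>v \<in> L\<close>] g] .
    show "((\<lambda>x. prod (f' x v) (g x)) has_derivative (\<lambda>_. 0)) (at u within D)"
      by (rule has_derivative_transform[where f = "\<lambda>_. 0"]) (use u vanish \<open>v \<in> L\<close> in auto)
  qed
  have "continuous (at u within D) (\<lambda>x. f'' v x w)" if "v \<in> L" for v w
    using f''_cont[OF that] u by (simp add: continuous_on_eq_continuous_within)
  with vw have "f'' v u w = f'' w u v"
    by (intro second_derivative_symmetric[OF L u vw f(2) f'' f''])
  with product_rule[OF vw] product_rule[OF vw(2,1)] show ?thesis
    by (simp add: add_eq_0_iff2)
qed

section \<open>The Hermitian product and the Kaehler form\<close>

interpretation matrix_vector_mult: bounded_bilinear
  "(*v) :: 'a::{euclidean_space, real_algebra_1}^'n^'m \<Rightarrow> 'a^'n \<Rightarrow> 'a^'m"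
  by (auto simp: bilinear_conv_bounded_bilinear[symmetric] bilinear_def matrix_vector_mult_def
      vec_eq_iff algebra_simps sum.distrib scaleR_sum_right intro!: linearI)

interpretation hermitian: bounded_bilinear "hermitian :: complex^'n \<Rightarrow> complex^'n \<Rightarrow> complex"
  by (auto simp: bilinear_conv_bounded_bilinear[symmetric] bilinear_def hermitian_def algebra_simps
      sum.distrib scaleR_sum_right intro!: linearI)

interpretation kaehler_form: bounded_bilinear "kaehler_form :: complex^'n \<Rightarrow> complex^'n \<Rightarrow> real"
  by (auto simp: bilinear_conv_bounded_bilinear[symmetric] bilinear_def kaehler_form_def
      hermitian.add_left hermitian.add_right hermitian.scaleR_left hermitian.scaleR_right
      intro!: linearI)

lemma hermitian_commute: "hermitian x y = cnj (hermitian y x)"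
  by (simp add: hermitian_def mult.commute)

lemma kaehler_form_skew: "kaehler_form x y = - kaehler_form y x"
  by (simp add: kaehler_form_def hermitian_commute[of x y])

lemma kaehler_form_self: "kaehler_form x x = 0"
  using kaehler_form_skew[of x x] by simp

lemma hermitian_scale_right: "hermitian x (c *s y) = cnj c * hermitian x y"
  by (simp add: hermitian_def sum_distrib_left algebra_simps)

lemma hermitian_conj_transpose: "hermitian (A *v x) y = hermitian x (conj_transpose A *v y)"
proof -
  have "hermitian (A *v x) y = (\<Sum>i\<in>UNIV. \<Sum>j\<in>UNIV. A $ i $ j * x $ j * cnj (y $ i))"
    by (simp add: hermitian_def matrix_vector_mult_def sum_distrib_right)
  also have "\<dots> = (\<Sum>j\<in>UNIV. \<Sum>i\<in>UNIV. A $ i $ j * x $ j * cnj (y $ i))"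
    by (rule sum.swap)
  also have "\<dots> = hermitian x (conj_transpose A *v y)"
    by (simp add: hermitian_def conj_transpose_def matrix_vector_mult_def sum_distrib_left
        algebra_simps)
  finally show ?thesis .
qed

lemma kaehler_form_add_scaleR_eq_0:
  assumes "kaehler_form v w = 0" and "kaehler_form v n = 0" and "kaehler_form w n = 0"
  shows "kaehler_form (v + r *\<^sub>R n) (w + s *\<^sub>R n) = 0"
  using assms kaehler_form_skew[of n w]
  by (simp add: kaehler_form.add_left kaehler_form.add_right kaehler_form.scaleR_left
      kaehler_form.scaleR_right kaehler_form_self)

lemma map_matrix_scale_vector_mult:
  fixes B :: "'a::semiring_1^'n^'m"
  shows "map_matrix (\<lambda>z. c * z) B *v x = c *s (B *v x)"
  by (simp add: vec_eq_iff matrix_vector_mult_def sum_distrib_left mult.assoc)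

section \<open>Initial data in local parametrizations\<close>

lemma local_param_has_derivative:
  assumes "local_param M X L D \<phi>"
  obtains f' where "\<And>x. x \<in> D \<Longrightarrow> ((X \<circ> \<phi>) has_derivative f' x) (at x within D)"
proof -
  have "Ck_on (Suc 0) D (X \<circ> \<phi>)"
    using assms by (simp only: local_param_def smooth_on_def)
  with that show thesis by auto
qed

lemma local_param_in_topspace:
  assumes "local_param M X L D \<phi>" and "u \<in> D"
  shows "\<phi> u \<in> topspace M"
  using assms openin_subset[of M "\<phi> ` D"] by (auto simp: local_param_def)

lemma tangent_spaceI:
  assumes "local_param M X L D \<phi>" and "u \<in> D"
    and "((X \<circ> \<phi>) has_derivative f') (at u within D)" and "v \<in> L"
  shows "f' v \<in> tangent_space M X (\<phi> u)"
  unfolding tangent_space_def using assms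
  by (intro CollectI exI[of _ L] exI[of _ D] exI[of _ \<phi>] exI[of _ u] exI[of _ f']
      exI[of _ v]) simp

lemma isotropic_submanifold_kaehler_form_eq_0:
  assumes "isotropic_submanifold k M X" and "local_param M X L D \<phi>" and "u \<in> D"
    and "((X \<circ> \<phi>) has_derivative f') (at u within D)" and "v \<in> L" and "w \<in> L"
  shows "kaehler_form (f' v) (f' w) = 0"
  using assms(1) local_param_in_topspace[OF assms(2,3)]
    tangent_spaceI[OF assms(2-5)] tangent_spaceI[OF assms(2-4,6)]
  by (simp add: isotropic_submanifold_def)

lemma initial_data_hermitian_eq_0:
  assumes "initial_data k M X B b" and "local_param M X L D \<phi>" and "u \<in> D"
    and "((X \<circ> \<phi>) has_derivative f') (at u within D)" and "v \<in> L"
  shows "hermitian (f' v) (B *v X (\<phi> u) + b) = 0"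
  using assms(1) local_param_in_topspace[OF assms(2,3)] tangent_spaceI[OF assms(2-5)]
  by (simp add: initial_data_def)

lemma initial_data_hermitian_symmetric:
  assumes init: "initial_data k M X B b" and par: "local_param M X L D \<phi>"
    and f': "\<And>x. x \<in> D \<Longrightarrow> ((X \<circ> \<phi>) has_derivative f' x) (at x within D)"
    and "u \<in> D" and "v \<in> L" and "w \<in> L"
  shows "hermitian (f' u v) (B *v f' u w) = hermitian (f' u w) (B *v f' u v)"
proof (rule hermitian.derivative_of_vanishing_pairing_symmetric[where f = "X \<circ> \<phi>" and f' = f'])
  show "((\<lambda>x. B *v (X \<circ> \<phi>) x + b) has_derivative (\<lambda>w. B *v f' u w)) (at u within D)"
    using matrix_vector_mult.FDERIV[OF has_derivative_const f'[OF \<open>u \<in> D\<close>], of B]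
    by (auto intro: has_derivative_eq_rhs[OF has_derivative_add[OF _ has_derivative_const]])
  show "hermitian (f' x v) (B *v (X \<circ> \<phi>) x + b) = 0" if "x \<in> D" "v \<in> L" for x v
    using initial_data_hermitian_eq_0[OF init par _ f'] that by simp
  show "Ck_on 2 D (X \<circ> \<phi>)" "subspace L" "openin (top_of_set L) D"
    using par by (simp_all only: local_param_def smooth_on_def)
qed (use assms in auto)

section \<open>The affine motion\<close>

lemma has_derivative_compose_fst:
  assumes "(f has_derivative f') (at x within S)"
  shows "((\<lambda>z. f (fst z)) has_derivative (\<lambda>z. f' (fst z))) (at (x, y) within S \<times> T)"
proof (rule has_derivative_in_compose[where f = fst])
  show "(f has_derivative f') (at (fst (x, y)) within fst ` (S \<times> T))"
    using assms by (auto intro: has_derivative_subset)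
qed (auto intro!: derivative_eq_intros)

lemma has_derivative_compose_snd:
  assumes "(f has_derivative f') (at y within T)"
  shows "((\<lambda>z. f (snd z)) has_derivative (\<lambda>z. f' (snd z))) (at (x, y) within S \<times> T)"
proof (rule has_derivative_in_compose[where f = snd])
  show "(f has_derivative f') (at (snd (x, y)) within snd ` (S \<times> T))"
    using assms by (auto intro: has_derivative_subset)
qed (auto intro!: derivative_eq_intros)

lemma has_derivative_affine_motion:
  fixes A :: "real \<Rightarrow> 'a::{euclidean_space, real_algebra_1}^'n^'m"
  assumes A: "(A has_vector_derivative A') (at s within I)"
    and a: "(a has_vector_derivative a') (at s within I)"
    and f: "(f has_derivative f') (at u within D)"
  shows "((\<lambda>(t, w). A t *v f w + a t) has_derivative
      (\<lambda>(r, v). A s *v f' v + r *\<^sub>R (A' *v f u + a'))) (at (s, u) within I \<times> D)"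
proof -
  have "((\<lambda>z. A (fst z) *v f (snd z) + a (fst z)) has_derivative
      (\<lambda>z. A s *v f' (snd z) + (fst z *\<^sub>R A') *v f u + fst z *\<^sub>R a')) (at (s, u) within I \<times> D)"
    using has_derivative_add[OF matrix_vector_mult.FDERIV[OF
          has_derivative_compose_fst[OF A[unfolded has_vector_derivative_def]]
          has_derivative_compose_snd[OF f]]
        has_derivative_compose_fst[OF a[unfolded has_vector_derivative_def]]]
    by simp
  then show ?thesis
    by (simp add: case_prod_beta' matrix_vector_mult.scaleR_left scaleR_add_right add.assoc)
qed

locale affine_motion =
  fixes B :: "complex^'n^'n" and b :: "complex^'n"
    and I :: "real set" and \<alpha> :: "real \<Rightarrow> complex"
    and A A' :: "real \<Rightarrow> complex^'n^'n" and a a' :: "real \<Rightarrow> complex^'n"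
  assumes interval: "is_interval I" and zero_in: "0 \<in> I"
    and A_deriv: "s \<in> I \<Longrightarrow> (A has_vector_derivative A' s) (at s within I)"
    and a_deriv: "s \<in> I \<Longrightarrow> (a has_vector_derivative a' s) (at s within I)"
    and A_ode: "s \<in> I \<Longrightarrow> conj_transpose (A s) ** A' s = map_matrix (\<lambda>z. \<alpha> s * z) B"
    and a_ode: "s \<in> I \<Longrightarrow> conj_transpose (A s) *v a' s = \<alpha> s *s b"
    and A_zero: "A 0 = mat 1"
begin

lemma hermitian_linear_velocity:
  assumes "s \<in> I"
  shows "hermitian (A s *v x) (A' s *v y) = cnj (\<alpha> s) * hermitian x (B *v y)"
  by (simp add: hermitian_conj_transpose matrix_vector_mul_assoc A_ode[OF assms]
      map_matrix_scale_vector_mult hermitian_scale_right)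

lemma hermitian_velocity:
  assumes "s \<in> I"
  shows "hermitian (A s *v x) (A' s *v y + a' s) = cnj (\<alpha> s) * hermitian x (B *v y + b)"
proof -
  have "hermitian (A s *v x) (a' s) = cnj (\<alpha> s) * hermitian x b"
    by (simp add: hermitian_conj_transpose a_ode[OF assms] hermitian_scale_right)
  then show ?thesis
    by (simp add: hermitian.add_right hermitian_linear_velocity[OF assms] distrib_left)
qed

lemma kaehler_form_preserved:
  assumes sym: "hermitian v (B *v w) = hermitian w (B *v v)" and "s \<in> I"
  shows "kaehler_form (A s *v v) (A s *v w) = kaehler_form v w"
proof -
  have A_apply: "((\<lambda>t. A t *v x) has_vector_derivative A' t *v x) (at t within I)"
    if "t \<in> I" for t x
    using matrix_vector_mult.has_vector_derivative[OF A_deriv[OF that] has_vector_derivative_const]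
    by simp
  have "((\<lambda>t. kaehler_form (A t *v v) (A t *v w)) has_vector_derivative 0) (at t within I)"
    if "t \<in> I" for t
  proof -
    have "hermitian (A t *v v) (A' t *v w) = hermitian (A t *v w) (A' t *v v)"
      by (simp add: hermitian_linear_velocity[OF that] sym)
    then have "kaehler_form (A t *v v) (A' t *v w) + kaehler_form (A' t *v v) (A t *v w) = 0"
      by (simp add: kaehler_form_def hermitian_commute[of "A' t *v v"])
    with kaehler_form.has_vector_derivative[OF A_apply A_apply, OF that that, of v w]
    show ?thesis by simp
  qed
  then obtain c where "\<And>t. t \<in> I \<Longrightarrow> kaehler_form (A t *v v) (A t *v w) = c"
    using has_vector_derivative_zero_constant[OF is_interval_convex[OF interval]] by blast
  from this[OF \<open>s \<in> I\<close>] this[OF zero_in] show ?thesis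
    by (simp add: A_zero)
qed

lemma isotropic_map_initial_data:
  assumes init: "initial_data k M X B b"
  shows "isotropic_map I M X (\<lambda>(s, p). A s *v X p + a s)"
  unfolding isotropic_map_def
proof (intro allI impI ballI)
  fix L D \<phi> s u
  assume par: "local_param M X L D \<phi>" and s: "s \<in> I" and u: "u \<in> D"
  obtain f' where f': "\<And>x. x \<in> D \<Longrightarrow> ((X \<circ> \<phi>) has_derivative f' x) (at x within D)"
    using local_param_has_derivative[OF par] by blast
  define n where "n = A' s *v X (\<phi> u) + a' s"
  define G where "G = (\<lambda>(r, v). A s *v f' u v + r *\<^sub>R n)"
  have tangent: "kaehler_form (A s *v f' u v) (A s *v f' u w) = 0" if "v \<in> L" "w \<in> L" for v w
  proof -
    have "kaehler_form (A s *v f' u v) (A s *v f' u w) = kaehler_form (f' u v) (f' u w)"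
      using s that by (intro kaehler_form_preserved initial_data_hermitian_symmetric[OF init par f' u])
    also have "\<dots> = 0"
      using init that unfolding initial_data_def
      by (auto intro: isotropic_submanifold_kaehler_form_eq_0[OF _ par u f'[OF u]])
    finally show ?thesis .
  qed
  have mixed: "kaehler_form (A s *v f' u v) n = 0" if "v \<in> L" for v
    using initial_data_hermitian_eq_0[OF init par u f'[OF u] that]
    by (simp add: n_def kaehler_form_def hermitian_velocity[OF s])
  have "\<forall>\<xi>\<in>UNIV \<times> L. \<forall>\<eta>\<in>UNIV \<times> L. kaehler_form (G \<xi>) (G \<eta>) = 0"
    by (auto simp: G_def intro!: kaehler_form_add_scaleR_eq_0 tangent mixed)
  moreover have "((\<lambda>(t, w). (\<lambda>(s, p). A s *v X p + a s) (t, \<phi> w)) has_derivative G)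
      (at (s, u) within I \<times> D)"
    using has_derivative_affine_motion[OF A_deriv[OF s] a_deriv[OF s] f'[OF u]]
    by (simp add: G_def n_def)
  ultimately show "\<exists>G. ((\<lambda>(t, w). (\<lambda>(s, p). A s *v X p + a s) (t, \<phi> w)) has_derivative G)
      (at (s, u) within I \<times> D) \<and>
      (\<forall>\<xi>\<in>UNIV \<times> L. \<forall>\<eta>\<in>UNIV \<times> L. kaehler_form (G \<xi>) (G \<eta>) = 0)"
    by blast
qed

end

theorem theorem3:
  fixes k :: nat
    and M :: "'a topology" and X :: "'a \<Rightarrow> complex^'n"
    and B :: "complex^'n^'n" and b :: "complex^'n"
    and I :: "real set" and \<alpha> :: "real \<Rightarrow> complex"
    and A :: "real \<Rightarrow> complex^'n^'n" and a :: "real \<Rightarrow> complex^'n"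
  assumes "isotropic_submanifold k M X"
    and "invertible B"
    and "initial_data k M X B b"
    and "is_interval I" and "0 \<in> I"
    and "smooth_on I \<alpha>"
    and "\<forall>s\<in>I. invertible (A s)"
    and "smooth_on I A" and "smooth_on I a"
    and "\<forall>s\<in>I. conj_transpose (A s) ** vector_derivative A (at s within I)
           = map_matrix (\<lambda>z. \<alpha> s * z) B"
    and "\<forall>s\<in>I. conj_transpose (A s) *v vector_derivative a (at s within I) = \<alpha> s *s b"
    and "A 0 = mat 1" and "a 0 = 0"
  shows "isotropic_map I M X (\<lambda>(s, p). A s *v X p + a s)"
proof -
  interpret affine_motion B b I \<alpha> A "\<lambda>s. vector_derivative A (at s within I)"
    a "\<lambda>s. vector_derivative a (at s within I)"
    using assms by unfold_locales (auto intro: smooth_on_has_vector_derivative)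
  show ?thesis
    using assms(3) by (rule isotropic_map_initial_data)
qed

end
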